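(* For every positive integer $n$ and every real $p \ge 3$ we have $$\left\|\frac{S_n}{\sqrt{n}}\right\|_p \ge e^{-\frac{p}{2n}} \|G\|_p.$$
   Context: Here $S_n = \varepsilon_1 + \ldots + \varepsilon_n$, where $\varepsilon_1,\ldots,\varepsilon_n$ are i.i.d. symmetric Bernoulli (Rademacher) random variables, i.e. $\mathbb{P}(\varepsilon_i = \pm 1) = \frac12$; $G \sim \mathcal{N}(0,1)$ is a standard Gaussian random variable; and $\|X\|_p = (\mathbb{E}|X|^p)^{1/p}$ for a real random variable $X$. *)

theory Defs
  imports "HOL-Probability.Probability"
begin

definition rademacher :: "'a measure \<Rightarrow> ('a \<Rightarrow> real) \<Rightarrow> bool" where
  "rademacher M X \<longleftrightarrow>
     X \<in> borel_measurable M \<and>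
     measure M {\<omega> \<in> space M. X \<omega> = 1} = 1 / 2 \<and>
     measure M {\<omega> \<in> space M. X \<omega> = - 1} = 1 / 2"

(* The Bochner integral is 0 on non-integrable functions, so this is the usual L^p norm only
   when |X| powr p is integrable. *)
definition Lp_norm :: "'a measure \<Rightarrow> real \<Rightarrow> ('a \<Rightarrow> real) \<Rightarrow> real" where
  "Lp_norm M p X = (\<integral>\<omega>. \<bar>X \<omega>\<bar> powr p \<partial>M) powr (1 / p)"

end

theory Submission
  imports Defs "HOL-Real_Asymp.Real_Asymp"
begin

text \<open>
  Write \<open>A q n\<close> for \<open>E \<bar>S\<^sub>n\<bar>\<^sup>q\<close> and
  \<open>\<gamma> q\<close> for \<open>E \<bar>G\<bar>\<^sup>q\<close>. Raised to the power
  \<open>p\<close>, the claim is \<open>A p n \<ge> exp (- p\<^sup>2 / (2 * n)) * n powr (p / 2) *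
  \<gamma> p\<close>. The proof lowers the exponent, so the same bound is established for every
  exponent \<open>q \<ge> 2\<close> in place of \<open>p\<close>; three arguments cover three
  ranges of \<open>q\<close>.

  If \<open>q \<ge> n\<close>, the factor \<open>exp (- q\<^sup>2 / (2 * n))\<close> is so small
  that the two extreme values \<open>\<plusminus>n\<close> of the walk give enough, together with
  a crude bound on \<open>\<gamma> q\<close> (\<open>walk_moment_bound_large_exponent\<close>).

  If \<open>4 \<le> q \<le> n\<close>, the exponent is lowered by \<open>2\<close>. Gaussian
  integration by parts gives \<open>\<gamma> q = (q - 1) * \<gamma> (q - 2)\<close>. Its discrete
  analogue \<open>walk_mean_stein\<close>, combined with the convexity of \<open>\<bar>x\<bar>
  powr (q - 2)\<close>, gives \<open>A q n \<ge> n * (q - 1) * A (q - 2) (n - 1)\<close>. The loss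
  in passing from \<open>n\<close> to \<open>n - 1\<close> is paid for by the change from
  \<open>(q - 2)\<^sup>2\<close> to \<open>q\<^sup>2\<close> in the exponential
  (\<open>walk_moment_bound_step\<close>).

  There remain \<open>2 \<le> q < 4\<close> and \<open>n \<ge> 3\<close>. The case \<open>q =
  2\<close> is an equality of variances. For \<open>2 < q < 4\<close> the power
  \<open>\<bar>x\<bar>\<^sup>q\<close> is a positive multiple of the integral over \<open>t >
  0\<close> of \<open>(cos (t * x) - 1 + (t * x)\<^sup>2 / 2) * t powr (- q - 1)\<close>. Hence
  \<open>A q n\<close> and \<open>n powr (q / 2) * \<gamma> q\<close> are the same multiple of the
  integrals of \<open>cos t ^ n - 1 + y\<close> and \<open>exp (- y) - 1 + y\<close> against
  \<open>t powr (- q - 1)\<close>, where \<open>y = n * t\<^sup>2 / 2\<close>. By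
  \<open>cos_power_deficit\<close> the first integrand is, at each \<open>t\<close>, at least
  \<open>1 - 4 / (3 * n)\<close> times the second, and
  \<open>1 - 4 / (3 * n) \<ge> exp (- 2 / n)\<close>.
\<close>

section \<open>The mean of a function of the Rademacher walk\<close>

text \<open>
  The mean of \<open>h S\<^sub>n\<close> depends on the joint law of the signs only. Encoding it
  as a positive linear functional on functions, obtained by averaging over one step at a time,
  makes every fact about the walk an induction on \<open>n\<close> in which the test function is
  replaced by its one-step average; no probability space has to be carried along when
  \<open>n\<close> changes.
\<close>

primrec walk_mean :: "nat \<Rightarrow> (real \<Rightarrow> real) \<Rightarrow> real" where
  "walk_mean 0 h = h 0"
| "walk_mean (Suc n) h = walk_mean n (\<lambda>x. (h (x + 1) + h (x - 1)) / 2)"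

lemma walk_mean_add: "walk_mean n (\<lambda>x. f x + g x) = walk_mean n f + walk_mean n g"
proof (induction n arbitrary: f g)
  case (Suc n)
  have "walk_mean (Suc n) (\<lambda>x. f x + g x)
      = walk_mean n (\<lambda>x. (f (x + 1) + f (x - 1)) / 2 + (g (x + 1) + g (x - 1)) / 2)"
    by (simp add: add_divide_distrib add_ac)
  then show ?case by (simp add: Suc.IH)
qed simp

lemma walk_mean_cmult: "walk_mean n (\<lambda>x. c * f x) = c * walk_mean n f"
proof (induction n arbitrary: f)
  case (Suc n)
  have "walk_mean (Suc n) (\<lambda>x. c * f x) = walk_mean n (\<lambda>x. c * ((f (x + 1) + f (x - 1)) / 2))"
    by (simp add: algebra_simps)
  then show ?case by (simp only: Suc.IH walk_mean.simps)
qed simp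

lemma walk_mean_mono: "(\<And>x. f x \<le> g x) \<Longrightarrow> walk_mean n f \<le> walk_mean n g"
proof (induction n arbitrary: f g)
  case (Suc n)
  have "(f (x + 1) + f (x - 1)) / 2 \<le> (g (x + 1) + g (x - 1)) / 2" for x
    by (intro divide_right_mono add_mono Suc.prems) simp
  then show ?case by (simp add: Suc.IH)
qed simp

lemma walk_mean_const: "walk_mean n (\<lambda>x. c) = c"
  by (induction n) auto

lemma walk_mean_square: "walk_mean n (\<lambda>x. x\<^sup>2) = real n"
proof (induction n)
  case (Suc n)
  have "((x + 1)\<^sup>2 + (x - 1)\<^sup>2) / 2 = x\<^sup>2 + 1" for x :: real
    by (simp add: power2_eq_square algebra_simps)
  then show ?case by (simp only: walk_mean.simps walk_mean_add walk_mean_const Suc.IH of_nat_Suc add.commute)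
qed simp

lemma walk_mean_cos: "walk_mean n (\<lambda>x. cos (t * x)) = cos t ^ n"
proof (induction n)
  case (Suc n)
  have "(cos (t * (x + 1)) + cos (t * (x - 1))) / 2 = cos t * cos (t * x)" for x :: real
    by (simp add: algebra_simps cos_add cos_diff)
  then show ?case by (simp add: walk_mean_cmult Suc.IH)
qed simp

lemma walk_mean_integral:
  assumes "\<And>x. integrable L (F x)"
  shows "integrable L (\<lambda>t. walk_mean n (\<lambda>x. F x t))"
    and "(\<integral>t. walk_mean n (\<lambda>x. F x t) \<partial>L) = walk_mean n (\<lambda>x. \<integral>t. F x t \<partial>L)"
proof -
  have "integrable L (\<lambda>t. walk_mean n (\<lambda>x. F x t)) \<and>
    (\<integral>t. walk_mean n (\<lambda>x. F x t) \<partial>L) = walk_mean n (\<lambda>x. \<integral>t. F x t \<partial>L)"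
    using assms
  proof (induction n arbitrary: F)
    case (Suc n)
    have "integrable L (\<lambda>t. (F (x + 1) t + F (x - 1) t) / 2)" for x
      using Suc.prems by auto
    from Suc.IH[OF this] show ?case
      using Suc.prems by simp
  qed simp
  then show "integrable L (\<lambda>t. walk_mean n (\<lambda>x. F x t))"
    and "(\<integral>t. walk_mean n (\<lambda>x. F x t) \<partial>L) = walk_mean n (\<lambda>x. \<integral>t. F x t \<partial>L)"
    by auto
qed

text \<open>
  All signs may equal \<open>1\<close>, or all may equal \<open>-1\<close>: these two extreme
  outcomes, each of probability \<open>1 / 2 ^ n\<close>, already carry enough of the moment when
  the exponent is at least \<open>n\<close>.
\<close>

lemma walk_mean_ge_endpoints:
  assumes "\<And>x. 0 \<le> h x"
  shows "(h (real (Suc n)) + h (- real (Suc n))) / 2 ^ Suc n \<le> walk_mean (Suc n) h"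
  using assms
proof (induction n arbitrary: h)
  case 0
  have "(h (real (Suc 0)) + h (- real (Suc 0))) / 2 ^ Suc 0 = walk_mean (Suc 0) h"
    by simp
  then show ?case by (rule eq_refl)
next
  case (Suc n)
  have average_le: "(a + b) / 2 \<le> c + d" if "a \<le> 2 * c" "b \<le> 2 * d" for a b c d :: real
    using that by simp
  define m where "m = (\<lambda>x. (h (x + 1) + h (x - 1)) / 2)"
  have "h (real (Suc (Suc n))) \<le> 2 * m (real (Suc n))"
    using Suc.prems[of "real n"] by (simp add: m_def add_ac)
  moreover have "h (- real (Suc (Suc n))) \<le> 2 * m (- real (Suc n))"
    using Suc.prems[of "- real n"] by (simp add: m_def algebra_simps)
  ultimately have "(h (real (Suc (Suc n))) + h (- real (Suc (Suc n)))) / 2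
      \<le> m (real (Suc n)) + m (- real (Suc n))"
    by (rule average_le)
  from divide_right_mono[OF this, of "2 ^ Suc n"]
  have "(h (real (Suc (Suc n))) + h (- real (Suc (Suc n)))) / 2 ^ Suc (Suc n)
      \<le> (m (real (Suc n)) + m (- real (Suc n))) / 2 ^ Suc n"
    by (simp add: divide_divide_eq_left)
  also have "\<dots> \<le> walk_mean (Suc n) m"
    by (rule Suc.IH) (simp add: m_def Suc.prems)
  finally show ?case by (simp only: m_def walk_mean.simps(2)[of "Suc n" h])
qed

text \<open>
  The discrete analogue of Gaussian integration by parts, \<open>E (G * f G) = E (f' G)\<close>.
  By symmetry \<open>E (S\<^sub>n * f S\<^sub>n) = n * E (\<epsilon>\<^sub>n * f (S' +
  \<epsilon>\<^sub>n))\<close>, where \<open>S'\<close> is the sum of the other signs, and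
  averaging over \<open>\<epsilon>\<^sub>n\<close> turns \<open>f\<close> into half its central
  difference. The induction uses that averaging and differencing commute.
\<close>

lemma walk_mean_stein:
  "walk_mean (Suc n) (\<lambda>x. x * f x)
     = real (Suc n) * walk_mean n (\<lambda>x. (f (x + 1) - f (x - 1)) / 2)"
proof (induction n arbitrary: f)
  case (Suc n)
  let ?m = "\<lambda>x. (f (x + 1) + f (x - 1)) / 2"
  let ?d = "\<lambda>x. (f (x + 1) - f (x - 1)) / 2"
  have "((x + 1) * f (x + 1) + (x - 1) * f (x - 1)) / 2 = x * ?m x + ?d x" for x
    by (simp add: field_simps)
  then have "walk_mean (Suc (Suc n)) (\<lambda>x. x * f x)
      = walk_mean (Suc n) (\<lambda>x. x * ?m x) + walk_mean (Suc n) ?d"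
    by (simp only: walk_mean.simps(2)[of "Suc n"] walk_mean_add)
  also have "walk_mean (Suc n) (\<lambda>x. x * ?m x) = real (Suc n) * walk_mean (Suc n) ?d"
  proof -
    have "(?m (x + 1) - ?m (x - 1)) / 2 = (?d (x + 1) + ?d (x - 1)) / 2" for x
      by (simp add: field_simps)
    then have "walk_mean n (\<lambda>x. (?m (x + 1) - ?m (x - 1)) / 2) = walk_mean (Suc n) ?d"
      by (simp only: walk_mean.simps(2))
    then show ?thesis by (simp only: Suc.IH[of ?m])
  qed
  finally show ?case by (simp add: algebra_simps)
qed simp

text \<open>
  The bridge to the given random variables. Splitting according to the last sign and using its
  independence of the other signs gives the recursion that defines
  \<^const>\<open>walk_mean\<close>. The two halves \<open>indicator {\<plusminus>1} (Y \<omega>)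
  * h (S \<omega> \<plusminus> 1)\<close> are products of independent functions, so integrability
  is inherited through the induction and holds for every Borel function \<open>h\<close>, bounded
  or not.
\<close>

lemma (in prob_space) rademacher_sum_expectation:
  assumes "indep_vars (\<lambda>_. borel) X {1..n}"
    and "\<And>i. i \<in> {1..n} \<Longrightarrow> rademacher M (X i)"
    and "h \<in> borel_measurable borel"
  shows "integrable M (\<lambda>\<omega>. h (\<Sum>i=1..n. X i \<omega>))"
    and "(\<integral>\<omega>. h (\<Sum>i=1..n. X i \<omega>) \<partial>M) = walk_mean n h"
proof -
  have "integrable M (\<lambda>\<omega>. h (\<Sum>i=1..n. X i \<omega>)) \<and>
      (\<integral>\<omega>. h (\<Sum>i=1..n. X i \<omega>) \<partial>M) = walk_mean n h"
    using assms
  proof (induction n arbitrary: h)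
    case 0
    then show ?case by (simp add: prob_space)
  next
    case (Suc n)
    note [measurable] = Suc.prems(3)
    define S where "S = (\<lambda>\<omega>. \<Sum>i=1..n. X i \<omega>)"
    define Y where "Y = X (Suc n)"
    have ins: "{1..Suc n} = insert (Suc n) {1..n}" by auto
    have IH: "integrable M (\<lambda>\<omega>. g (S \<omega>)) \<and> (\<integral>\<omega>. g (S \<omega>) \<partial>M) = walk_mean n g"
      if "g \<in> borel_measurable borel" for g
      unfolding S_def using Suc.prems that
      by (intro Suc.IH indep_vars_subset[OF Suc.prems(1)]) auto
    have "rademacher M Y" using Suc.prems(2) by (simp add: Y_def)
    then have Y[measurable]: "Y \<in> borel_measurable M"
      and Yp: "prob {\<omega>\<in>space M. Y \<omega> = 1} = 1/2" and Ym: "prob {\<omega>\<in>space M. Y \<omega> = -1} = 1/2"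
      by (auto simp: rademacher_def)
    have S[measurable]: "S \<in> borel_measurable M"
      unfolding S_def using Suc.prems(2) by (intro borel_measurable_sum) (auto simp: rademacher_def)
    have ind: "indep_var borel Y borel S"
      unfolding Y_def S_def using Suc.prems(1) ins by (intro indep_vars_sum) auto
    have half: "integrable M (\<lambda>\<omega>. indicator {s} (Y \<omega>) * h (S \<omega> + s)) \<and>
        (\<integral>\<omega>. indicator {s} (Y \<omega>) * h (S \<omega> + s) \<partial>M) = walk_mean n (\<lambda>x. h (x + s)) / 2"
      if s: "prob {\<omega>\<in>space M. Y \<omega> = s} = 1/2" for s :: real
    proof -
      have "indep_var borel ((\<lambda>y. indicator {s} y :: real) \<circ> Y) borel ((\<lambda>x. h (x + s)) \<circ> S)"
        by (intro indep_var_compose[OF ind]) auto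
      then have i: "indep_var borel (\<lambda>\<omega>. indicator {s} (Y \<omega>) :: real) borel (\<lambda>\<omega>. h (S \<omega> + s))"
        by (simp add: comp_def)
      have int1: "integrable M (\<lambda>\<omega>. indicator {s} (Y \<omega>) :: real)"
        by (rule integrable_const_bound[where B=1]) (auto simp: indicator_def)
      have "(\<integral>\<omega>. indicator {s} (Y \<omega>) \<partial>M)
          = (\<integral>\<omega>. indicator {\<omega>\<in>space M. Y \<omega> = s} \<omega> \<partial>M)"
        by (intro Bochner_Integration.integral_cong) (auto simp: indicator_def)
      also have "\<dots> = prob {\<omega>\<in>space M. Y \<omega> = s}"
        by (simp add: Int_absorb2)
      finally have val: "(\<integral>\<omega>. indicator {s} (Y \<omega>) \<partial>M) = (1/2 :: real)"
        using s by simp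
      have m: "(\<lambda>x. h (x + s)) \<in> borel_measurable borel" by measurable
      show ?thesis
        using indep_var_integrable[OF i int1] indep_var_lebesgue_integral[OF i int1] IH[OF m] val
        by simp
    qed
    have "prob ({\<omega>\<in>space M. Y \<omega> = 1} \<union> {\<omega>\<in>space M. Y \<omega> = -1}) = 1"
      by (subst finite_measure_Union) (auto simp: Yp Ym)
    then have "AE \<omega> in M. \<omega> \<in> {\<omega>\<in>space M. Y \<omega> = 1} \<union> {\<omega>\<in>space M. Y \<omega> = -1}"
      by (subst (asm) prob_eq_1) auto
    then have ae: "AE \<omega> in M. indicator {1} (Y \<omega>) * h (S \<omega> + 1) + indicator {-1} (Y \<omega>) * h (S \<omega> + (- 1))
        = h (\<Sum>i=1..Suc n. X i \<omega>)"
      by eventually_elim (auto simp: S_def Y_def)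
    have meas: "(\<lambda>\<omega>. h (\<Sum>i=1..Suc n. X i \<omega>)) \<in> borel_measurable M"
    proof -
      have "(\<lambda>\<omega>. \<Sum>i=1..Suc n. X i \<omega>) \<in> borel_measurable M"
        using Suc.prems(2) by (intro borel_measurable_sum) (auto simp: rademacher_def)
      then show ?thesis by measurable
    qed
    let ?r = "\<lambda>\<omega>. indicator {1} (Y \<omega>) * h (S \<omega> + 1) + indicator {-1} (Y \<omega>) * h (S \<omega> + (- 1))"
    have r: "integrable M ?r" using half[OF Yp] half[OF Ym] by auto
    have 1: "integrable M (\<lambda>\<omega>. h (\<Sum>i=1..Suc n. X i \<omega>))"
      by (rule integrable_cong_AE_imp[OF r meas ae])
    have "(\<integral>\<omega>. h (\<Sum>i=1..Suc n. X i \<omega>) \<partial>M) = (\<integral>\<omega>. ?r \<omega> \<partial>M)"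
      by (rule integral_cong_AE[OF borel_measurable_integrable[OF r] meas ae, symmetric])
    also have "\<dots> = walk_mean n (\<lambda>x. h (x + 1)) / 2 + walk_mean n (\<lambda>x. h (x + - 1)) / 2"
      by (subst Bochner_Integration.integral_add[OF half[OF Yp, THEN conjunct1] half[OF Ym, THEN conjunct1]])
        (simp only: half[OF Yp, THEN conjunct2] half[OF Ym, THEN conjunct2])
    also have "\<dots> = walk_mean n (\<lambda>x. 1/2 * (h (x + 1) + h (x - 1)))"
      by (simp only: walk_mean_add walk_mean_cmult) simp
    also have "\<dots> = walk_mean (Suc n) h" by simp
    finally show ?case using 1 by blast
  qed
  then show "integrable M (\<lambda>\<omega>. h (\<Sum>i=1..n. X i \<omega>))"
    and "(\<integral>\<omega>. h (\<Sum>i=1..n. X i \<omega>) \<partial>M) = walk_mean n h" by auto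
qed

section \<open>Increments of signed powers\<close>

lemma DERIV_signed_powr:
  fixes x r :: real
  assumes "r > 0"
  shows "((\<lambda>x. x * \<bar>x\<bar> powr r) has_real_derivative (r + 1) * \<bar>x\<bar> powr r) (at x)"
proof -
  have pos: "((\<lambda>x. x * \<bar>x\<bar> powr r) has_real_derivative (r + 1) * \<bar>x\<bar> powr r) (at x)" if "x > 0" for x
  proof (rule DERIV_cong_ev[THEN iffD2, OF refl _ refl])
    show "\<forall>\<^sub>F y in nhds x. y * \<bar>y\<bar> powr r = y powr (r + 1)"
      using eventually_nhds_in_open[of "{0<..}" x] that
      by (auto elim!: eventually_mono simp: powr_add)
    show "((\<lambda>y. y powr (r + 1)) has_real_derivative (r + 1) * \<bar>x\<bar> powr r) (at x)"
      using has_real_derivative_powr[OF that, of "r + 1"] that by simp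
  qed
  \<comment> \<open>The function is odd, so the negative axis follows; at \<open>0\<close> the difference quotient is \<open>\<bar>h\<bar> powr r\<close>.\<close>
  consider "x > 0" | "x < 0" | "x = 0" by linarith
  then show ?thesis
  proof cases
    case 2
    have "((\<lambda>y. - ((- y) * \<bar>- y\<bar> powr r)) has_real_derivative - (((r + 1) * \<bar>- x\<bar> powr r) * (- 1))) (at x)"
      using 2 by (intro DERIV_minus DERIV_chain2[OF pos]) (auto intro!: derivative_eq_intros)
    then show ?thesis by simp
  next
    case 3
    have "((\<lambda>h. \<bar>h\<bar> powr r) \<longlongrightarrow> 0) (at (0::real))"
      using assms by (auto intro!: tendsto_eq_intros)
    then have "((\<lambda>h. (h * \<bar>h\<bar> powr r) / h) \<longlongrightarrow> 0) (at (0::real))"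
      by (rule Lim_transform_eventually) (auto simp: eventually_at_filter)
    then show ?thesis using 3 assms by (simp add: DERIV_def)
  qed (rule pos)
qed

text \<open>
  Convexity of \<open>\<bar>x\<bar>\<^sup>r\<close> on the whole line. The library's convexity of
  powers concerns the open half line, so the case where one end point is \<open>0\<close> is
  treated by hand.
\<close>

lemma abs_powr_midpoint:
  fixes x t r :: real
  assumes "r \<ge> 1"
  shows "2 * \<bar>x\<bar> powr r \<le> \<bar>x + t\<bar> powr r + \<bar>x - t\<bar> powr r"
proof -
  let ?a = "\<bar>x + t\<bar>" and ?b = "\<bar>x - t\<bar>"
  have "\<bar>x\<bar> powr r \<le> ((?a + ?b) / 2) powr r"
    using assms by (intro powr_mono2) auto
  also have "2 * ((?a + ?b) / 2) powr r \<le> ?a powr r + ?b powr r"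
  proof (cases "?a = 0 \<or> ?b = 0")
    case True
    then obtain c where c: "c \<ge> 0" "?a + ?b = c" "?a powr r + ?b powr r = c powr r"
      using assms by fastforce
    have "2 \<le> 2 powr r" using assms powr_mono[of 1 r 2] by simp
    then have "c powr r * 2 \<le> c powr r * 2 powr r" by (intro mult_left_mono) auto
    then have "2 * (c / 2) powr r \<le> c powr r"
      using c(1) by (simp add: powr_divide field_simps)
    then show ?thesis by (simp add: c)
  next
    case False
    have "((1 - 1/2) *\<^sub>R ?a + (1/2) *\<^sub>R ?b) powr r \<le> (1 - 1/2) * ?a powr r + (1/2) * ?b powr r"
      using False by (intro convex_onD[OF powr_convex[OF assms]]) auto
    then show ?thesis by (simp add: field_simps)
  qed
  finally show ?thesis by simp
qed

text \<open>
  The central difference of \<open>f x = x * \<bar>x\<bar>\<^sup>r\<close> is the average of its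
  derivative \<open>(r + 1) * \<bar>x\<bar>\<^sup>r\<close> over \<open>[x - 1, x + 1]\<close>.
  This derivative is convex because \<open>r \<ge> 1\<close>, so the average is at least the value
  at the midpoint. Letting the half-width of the interval grow from \<open>0\<close> to
  \<open>1\<close> turns this into a monotonicity statement.
\<close>

lemma signed_powr_increment_ge:
  fixes x r :: real
  assumes "r \<ge> 1"
  defines "f \<equiv> \<lambda>x. x * \<bar>x\<bar> powr r"
  shows "(r + 1) * \<bar>x\<bar> powr r \<le> (f (x + 1) - f (x - 1)) / 2"
proof -
  let ?g = "\<lambda>t. f (x + t) - f (x - t) - 2 * t * ((r + 1) * \<bar>x\<bar> powr r)"
  have "?g 0 \<le> ?g 1"
  proof (rule DERIV_nonneg_imp_nondecreasing, simp, intro exI conjI)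
    fix t :: real
    let ?d = "(r + 1) * \<bar>x + t\<bar> powr r + (r + 1) * \<bar>x - t\<bar> powr r - 2 * ((r + 1) * \<bar>x\<bar> powr r)"
    have "((\<lambda>t. f (x + t)) has_real_derivative (r + 1) * \<bar>x + t\<bar> powr r * 1) (at t)"
      "((\<lambda>t. f (x - t)) has_real_derivative (r + 1) * \<bar>x - t\<bar> powr r * (-1)) (at t)"
      using assms(1) unfolding f_def
      by (intro DERIV_chain2[OF DERIV_signed_powr, where g="\<lambda>t. x + t"]
          DERIV_chain2[OF DERIV_signed_powr, where g="\<lambda>t. x - t"];
          auto intro!: derivative_eq_intros)+
    then show "(?g has_real_derivative ?d) (at t)"
      by (auto intro!: derivative_eq_intros)
    have "?d = (r + 1) * (\<bar>x + t\<bar> powr r + \<bar>x - t\<bar> powr r - 2 * \<bar>x\<bar> powr r)"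
      by (simp add: algebra_simps)
    then show "0 \<le> ?d"
      using abs_powr_midpoint[OF assms(1), of x t] assms(1) by simp
  qed
  then show ?thesis by simp
qed

section \<open>Absolute moments of the standard Gaussian\<close>

definition gauss_moment :: "real \<Rightarrow> real" where
  "gauss_moment q = (\<integral>x. \<bar>x\<bar> powr q \<partial>std_normal_distribution)"

text \<open>
  The constant is the maximum of \<open>\<bar>x\<bar>\<^sup>q * exp (- 3 * x\<^sup>2 / 8)\<close>,
  attained at \<open>x\<^sup>2 = 4 * q / 3\<close>. The factor \<open>3 / 8 < 1 / 2\<close> leaves
  a Gaussian of standard deviation \<open>2\<close> when the right-hand side is multiplied by the
  standard normal density.
\<close>

lemma abs_powr_le_exp_square:
  fixes x q :: real
  assumes "q > 0"
  shows "\<bar>x\<bar> powr q \<le> (4 * q / (3 * exp 1)) powr (q / 2) * exp (3 * x\<^sup>2 / 8)"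
proof (cases "x = 0")
  case False
  define z where "z = 3 * x\<^sup>2 / (4 * q)"
  have z: "z > 0" using False assms by (simp add: z_def)
  have "ln z \<le> z - 1" using z by (rule ln_le_minus_one)
  then have "q / 2 * ln z \<le> q / 2 * (z - 1)" using assms by (intro mult_left_mono) auto
  moreover have "q / 2 * ln z = q * ln \<bar>x\<bar> - q / 2 * ln (4 * q / 3)"
  proof -
    have lnz: "ln z = 2 * ln \<bar>x\<bar> - ln (4 * q / 3)"
      using False assms ln_realpow[of "\<bar>x\<bar>" 2] by (simp add: z_def ln_div ln_mult)
    show ?thesis unfolding lnz by (simp only: right_diff_distrib)
  qed
  moreover have "q / 2 * (z - 1) = 3 * x\<^sup>2 / 8 - q / 2"
    using assms by (simp add: z_def field_simps)
  ultimately have "q * ln \<bar>x\<bar> \<le> q / 2 * (ln (4 * q / 3) - 1) + 3 * x\<^sup>2 / 8"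
    by (simp add: right_diff_distrib)
  moreover have "ln (4 * q / (3 * exp 1)) = ln (4 * q / 3) - 1"
    using assms by (simp add: ln_div ln_mult)
  ultimately show ?thesis
    using False assms by (simp add: powr_def flip: exp_add)
qed simp

lemma std_normal_tilt:
  "std_normal_density x * exp (3 * x\<^sup>2 / 8) = 2 * normal_density 0 2 x"
proof -
  have "sqrt (2 * pi * 2\<^sup>2) = 2 * sqrt (2 * pi)"
    unfolding real_sqrt_mult by simp
  then show ?thesis
    by (simp add: normal_density_def field_simps flip: exp_add)
qed

lemma std_normal_abs_powr:
  assumes "q > 0"
  shows "integrable std_normal_distribution (\<lambda>x. \<bar>x\<bar> powr q)"
    and "gauss_moment q \<le> 2 * (4 * q / (3 * exp 1)) powr (q / 2)"
proof -
  define C where "C = (4 * q / (3 * exp 1)) powr (q / 2)"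
  have b: "std_normal_density x * \<bar>x\<bar> powr q \<le> 2 * C * normal_density 0 2 x" for x
  proof -
    have "std_normal_density x * \<bar>x\<bar> powr q \<le> std_normal_density x * (C * exp (3 * x\<^sup>2 / 8))"
      using abs_powr_le_exp_square[OF assms] by (intro mult_left_mono) (auto simp: C_def)
    also have "\<dots> = C * (2 * normal_density 0 2 x)"
      by (simp flip: std_normal_tilt)
    finally show ?thesis by simp
  qed
  have int2: "integrable lborel (\<lambda>x. 2 * C * normal_density 0 2 x)"
    by (intro integrable_mult_right integrable_normal_density) simp
  have int: "integrable lborel (\<lambda>x. std_normal_density x * \<bar>x\<bar> powr q)"
    by (rule Bochner_Integration.integrable_bound[OF int2]) (use b in \<open>auto simp: C_def\<close>)
  then show "integrable std_normal_distribution (\<lambda>x. \<bar>x\<bar> powr q)"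
    by (simp add: integrable_density)
  have "gauss_moment q = (\<integral>x. std_normal_density x * \<bar>x\<bar> powr q \<partial>lborel)"
    unfolding gauss_moment_def by (simp add: integral_density)
  also have "\<dots> \<le> (\<integral>x. 2 * C * normal_density 0 2 x \<partial>lborel)"
    using int int2 b by (intro integral_mono) auto
  finally show "gauss_moment q \<le> 2 * (4 * q / (3 * exp 1)) powr (q / 2)"
    by (simp add: C_def)
qed

lemma gauss_moment_nonneg: "0 \<le> gauss_moment q"
  by (simp add: gauss_moment_def)

text \<open>
  Integration by parts: the derivative of \<open>x * \<bar>x\<bar> powr (q - 2) * \<phi>
  x\<close>, with \<open>\<phi>\<close> the normal density, is \<open>((q - 1) * \<bar>x\<bar>
  powr (q - 2) - \<bar>x\<bar> powr q) * \<phi> x\<close>, and it integrates to \<open>0\<close>.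
\<close>

lemma gauss_moment_step:
  assumes "q > 2"
  shows "gauss_moment q = (q - 1) * gauss_moment (q - 2)"
proof -
  define r where "r = q - 2"
  have r: "r > 0" using assms by (simp add: r_def)
  let ?f = "\<lambda>x::real. x * \<bar>x\<bar> powr r"
  let ?F = "\<lambda>x. ?f x * std_normal_density x"
  let ?d = "\<lambda>x. (r + 1) * (std_normal_density x * \<bar>x\<bar> powr r) - std_normal_density x * \<bar>x\<bar> powr q"
  have sq: "x * (x * \<bar>x\<bar> powr r) = \<bar>x\<bar> powr q" for x :: real
  proof (cases "x = 0")
    case False
    then have "\<bar>x\<bar> powr 2 = x * x" by (simp add: power2_eq_square)
    then have "x * (x * \<bar>x\<bar> powr r) = \<bar>x\<bar> powr 2 * \<bar>x\<bar> powr r"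
      by (simp only: mult.assoc)
    also have "\<dots> = \<bar>x\<bar> powr q"
      unfolding powr_add[symmetric] r_def by simp
    finally show ?thesis .
  qed simp
  have dens: "(std_normal_density has_real_derivative - x * std_normal_density x) (at x)" for x
  proof -
    have "((\<lambda>x. 1 / sqrt (2 * pi) * exp (- x\<^sup>2 / 2)) has_real_derivative
        1 / sqrt (2 * pi) * (exp (- x\<^sup>2 / 2) * (- x))) (at x)"
      by (intro DERIV_cmult) (auto intro!: derivative_eq_intros)
    then show ?thesis by (simp add: std_normal_density_def [abs_def] mult_ac)
  qed
  have F: "(?F has_vector_derivative ?d x) (at x)" for x
  proof -
    have "(?F has_real_derivative (r + 1) * \<bar>x\<bar> powr r * std_normal_density x
        + - x * std_normal_density x * ?f x) (at x)"
      by (intro DERIV_mult DERIV_signed_powr r dens)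
    moreover have "(r + 1) * \<bar>x\<bar> powr r * std_normal_density x
        + - x * std_normal_density x * ?f x = ?d x"
      unfolding sq[symmetric] by (simp only: algebra_simps)
    ultimately show ?thesis by (simp only: has_real_derivative_iff_has_vector_derivative)
  qed
  have int: "integrable lborel (\<lambda>x. std_normal_density x * \<bar>x\<bar> powr r)"
     "integrable lborel (\<lambda>x. std_normal_density x * \<bar>x\<bar> powr q)"
    using std_normal_abs_powr(1)[of r] std_normal_abs_powr(1)[of q] r assms
    by (simp_all add: integrable_density)
  have lim: "(?F \<longlongrightarrow> 0) at_top" 
  proof -
    have "((\<lambda>x. x * x powr r * exp (- x\<^sup>2 / 2) / sqrt (2 * pi)) \<longlongrightarrow> 0) at_top"
      by real_asymp
    then show ?thesis
      by (rule Lim_transform_eventually)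
        (use eventually_gt_at_top[of 0] in \<open>eventually_elim, simp add: std_normal_density_def\<close>)
  qed
  have lim': "(?F \<longlongrightarrow> 0) at_bot" 
    unfolding at_bot_mirror filterlim_filtermap 
    using tendsto_minus[OF lim] by (simp add: std_normal_density_def)
  have "(LBINT x=-\<infinity>..\<infinity>. ?d x) = 0 - 0"
  proof (rule interval_integral_FTC_integrable)
    show "isCont ?d x" for x
      unfolding std_normal_density_def using r assms
      by (auto intro!: continuous_intros)
    show "set_integrable lborel (einterval (-\<infinity>) \<infinity>) ?d"
      using int by (simp add: set_integrable_def)
    show "((?F \<circ> real_of_ereal) \<longlongrightarrow> 0) (at_right (-\<infinity>))"
      "((?F \<circ> real_of_ereal) \<longlongrightarrow> 0) (at_left \<infinity>)"
      using lim lim' by (simp_all add: ereal_tendsto_simps1)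
  qed (use F in auto)
  then have "(\<integral>x. ?d x \<partial>lborel) = 0"
    by (simp add: interval_integral_to_infinity_eq interval_lebesgue_integral_def set_lebesgue_integral_def)
  then show ?thesis
    using int by (simp add: gauss_moment_def integral_density r_def)
qed

section \<open>Powers of the cosine against the Gaussian\<close>

lemma cos_ge_quadratic: "1 - x\<^sup>2 / 2 \<le> cos x" for x :: real
proof -
  have "cos x = 1 - 2 * (sin (x / 2))\<^sup>2"
    using cos_double_sin[of "x / 2"] by simp
  moreover have "(sin (x / 2))\<^sup>2 \<le> (x / 2)\<^sup>2"
    using abs_sin_x_le_abs_x[of "x / 2"] by (subst abs_le_square_iff[symmetric])
  ultimately show ?thesis by (simp add: power_divide)
qed

lemma cos_le_quartic: "cos x \<le> 1 - x\<^sup>2 / 2 + x ^ 4 / 24" for x :: real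
proof -
  obtain t where "cos x = (\<Sum>m<4. cos_coeff m * x ^ m) + (cos (t + 1/2 * real (4::nat) * pi) / fact 4) * x ^ 4"
    using Maclaurin_cos_expansion[of x 4] by blast
  then have "cos x = 1 - x\<^sup>2 / 2 + cos (t + 2 * pi) * (x ^ 4 / 24)"
    by (simp add: cos_coeff_def lessThan_nat_numeral fact_numeral)
  moreover have "cos (t + 2 * pi) * (x ^ 4 / 24) \<le> 1 * (x ^ 4 / 24)"
    by (intro mult_right_mono cos_le_one) auto
  ultimately show ?thesis by simp
qed

lemma cos_ge_sextic: "1 - x\<^sup>2 / 2 + x ^ 4 / 24 - x ^ 6 / 720 \<le> cos x" for x :: real
proof -
  obtain t where "cos x = (\<Sum>m<6. cos_coeff m * x ^ m) + (cos (t + 1/2 * real (6::nat) * pi) / fact 6) * x ^ 6"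
    using Maclaurin_cos_expansion[of x 6] by blast
  then have "cos x = 1 - x\<^sup>2 / 2 + x ^ 4 / 24 + cos (t + 3 * pi) * (x ^ 6 / 720)"
    by (simp add: cos_coeff_def lessThan_nat_numeral fact_numeral)
  moreover have "- 1 * (x ^ 6 / 720) \<le> cos (t + 3 * pi) * (x ^ 6 / 720)"
    by (intro mult_right_mono cos_ge_minus_one) auto
  ultimately show ?thesis by simp
qed

lemma exp_minus_le_quadratic:
  fixes z :: real
  assumes "z \<ge> 0"
  shows "exp (- z) \<le> 1 - z + z\<^sup>2 / 2"
proof -
  obtain t where "exp (- z) = (\<Sum>m<3. (- z) ^ m / fact m) + (exp t / fact 3) * (- z) ^ 3"
    using Maclaurin_exp_le[of "- z" 3] by blast
  then have "exp (- z) = 1 - z + z\<^sup>2 / 2 - exp t / 6 * z ^ 3"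
    by (simp add: lessThan_nat_numeral fact_numeral)
  then show ?thesis using assms by simp
qed

text \<open>
  After multiplication by \<open>exp y\<close> this says \<open>y\<^sup>2 / 2 \<le> 1 - exp y + y
  * exp y\<close>; both sides vanish at \<open>0\<close>, and their derivatives are
  \<open>y\<close> and \<open>y * exp y\<close>.
\<close>

lemma square_exp_minus_le:
  fixes y :: real
  assumes "y \<ge> 0"
  shows "y\<^sup>2 * exp (- y) \<le> 2 * (exp (- y) - 1 + y)"
proof -
  let ?g = "\<lambda>y::real. 1 - exp y + y * exp y - y\<^sup>2 / 2"
  have "?g 0 \<le> ?g y"
  proof (rule DERIV_nonneg_imp_nondecreasing[OF assms], intro exI conjI)
    fix x :: real assume "0 \<le> x"
    then have "x * 1 \<le> x * exp x" by (intro mult_left_mono) auto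
    then show "0 \<le> x * exp x - x" by simp
    show "(?g has_real_derivative x * exp x - x) (at x)"
      by (auto intro!: derivative_eq_intros)
  qed
  then have "exp (- y) * y\<^sup>2 \<le> exp (- y) * (2 * (1 - exp y + y * exp y))"
    by (intro mult_left_mono) auto
  also have "\<dots> = 2 * (exp (- y) - 1 + y)"
    by (simp add: exp_minus field_simps)
  finally show ?thesis by (simp add: mult.commute)
qed

text \<open>
  Put \<open>a = exp (- t\<^sup>2 / 2)\<close> and \<open>b = cos t\<close>. Near \<open>0\<close>
  these agree up to about \<open>t\<^sup>4 / 12\<close>, and Bernoulli's inequality gives \<open>a
  ^ n - b ^ n \<le> n * a ^ (n - 1) * (a - b)\<close>. In terms of \<open>y\<close> the bound is a
  multiple of \<open>y\<^sup>2 * exp (- y) / n\<close>, with leading constant \<open>1 / 3\<close>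
  before the losses; the previous estimate turns \<open>y\<^sup>2 * exp (- y)\<close> into the
  right-hand side.
\<close>

lemma cos_power_deficit_small:
  fixes t :: real and n :: nat
  assumes "n \<ge> 1" "0 \<le> t" "t \<le> 1"
  defines "y \<equiv> real n * t\<^sup>2 / 2"
  shows "exp (- y) - cos t ^ n \<le> 4 / (3 * real n) * (exp (- y) - 1 + y)"
proof -
  define a b where "a = exp (- t\<^sup>2 / 2)" and "b = cos t"
  have a: "a > 0" by (simp add: a_def)
  have b: "b \<ge> 0" unfolding b_def using assms pi_ge_two by (intro cos_ge_zero) auto
  have an: "a ^ n = exp (- y)"
    by (simp add: a_def y_def flip: exp_of_nat_mult)
  have "1 + real n * (b / a - 1) \<le> (1 + (b / a - 1)) ^ n"
    using a b by (intro Bernoulli_inequality) auto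
  then have "a ^ n * (1 + real n * (b / a - 1)) \<le> b ^ n"
    using a by (simp add: power_divide field_simps)
  then have "exp (- y) - b ^ n \<le> exp (- y) * (real n * ((a - b) / a))"
    using a by (simp add: an field_simps)
  \<comment> \<open>\<open>61 / 720 = 1 / 12 + 1 / 720\<close> absorbs the sixth-order term of the cosine, and \<open>7 / 4\<close>
    bounds \<open>exp (1 / 2)\<close>, hence \<open>1 / a\<close>.\<close>
  also have "\<dots> \<le> exp (- y) * (real n * (61 / 720 * t ^ 4 * (7 / 4)))"
  proof -
    have "t ^ 6 \<le> t ^ 4" using assms by (intro power_decreasing) auto
    moreover have "a \<le> 1 - t\<^sup>2 / 2 + t ^ 4 / 8"
      using exp_minus_le_quadratic[of "t\<^sup>2 / 2"] by (simp add: a_def power_divide flip: power_mult)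
    ultimately have ab: "a - b \<le> 61 / 720 * t ^ 4"
      using cos_ge_sextic[of t] by (simp add: b_def)
    have "exp (1/2 :: real) ^ 2 \<le> (7 / 4)\<^sup>2"
      using exp_le by (simp add: power2_eq_square flip: exp_add)
    then have "exp (1/2 :: real) \<le> 7 / 4"
      by (rule power2_le_imp_le) simp
    moreover have "1 / a \<le> exp (1/2)"
      using assms power_mono[of t 1 2] by (simp add: a_def exp_minus field_simps)
    ultimately have "(a - b) * (1 / a) \<le> 61 / 720 * t ^ 4 * (7 / 4)"
      using ab a by (intro mult_mono) auto
    then show ?thesis by (intro mult_left_mono) auto
  qed
  also have "\<dots> = 427 / 720 / real n * (y\<^sup>2 * exp (- y))"
    using assms(1) by (simp add: y_def power2_eq_square power4_eq_xxxx field_simps)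
  also have "\<dots> \<le> 427 / 720 / real n * (2 * (exp (- y) - 1 + y))"
    by (intro mult_left_mono square_exp_minus_le) (auto simp: y_def)
  also have "\<dots> = 2 * (427 / 720 / real n) * (exp (- y) - 1 + y)"
    by (simp only: mult_ac)
  also have "\<dots> \<le> 4 / (3 * real n) * (exp (- y) - 1 + y)"
    using assms(1) exp_ge_add_one_self[of "- y"]
    by (intro mult_right_mono) (auto simp: field_simps)
  finally show ?thesis by (simp add: b_def)
qed

text \<open>
  This pointwise comparison of the characteristic functions of \<open>S\<^sub>n\<close> and of a
  Gaussian with the same variance drives the proof for exponents between \<open>2\<close> and
  \<open>4\<close>. The first falls short of the second by at most a fraction of order \<open>1 /
  n\<close> of the nonnegative quantity \<open>exp (- y) - 1 + y\<close>, whose integral against a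
  power of \<open>t\<close> represents the Gaussian moment. For \<open>t\<close> away from
  \<open>0\<close> there is a lot of room: \<open>y\<close> is of order \<open>n\<close>, so the
  right-hand side is bounded below by a constant. It suffices to know that \<open>cos t\<close> is
  nonnegative up to \<open>pi / 2\<close> and to use \<open>cos t ^ n \<ge> -1\<close> beyond,
  which also covers the points near multiples of \<open>pi\<close> where \<open>cos t ^ n\<close>
  is close to \<open>-1\<close>.
\<close>

lemma cos_power_deficit:
  fixes t :: real and n :: nat
  assumes n: "n \<ge> 3" and t: "t \<ge> 0"
  defines "y \<equiv> real n * t\<^sup>2 / 2"
  shows "exp (- y) - cos t ^ n \<le> 4 / (3 * real n) * (exp (- y) - 1 + y)"
proof -
  have pos: "exp (- y) - 1 + y \<ge> 0" using exp_ge_add_one_self[of "- y"] by simp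
  have exp_y: "exp (- y) \<le> 1 / (1 + y + y\<^sup>2 / 2)" "exp (- y) \<le> 1 / (1 + y)" if "y > 0"
    using that exp_lower_Taylor_quadratic[of y] exp_ge_add_one_self[of y]
    by (auto simp: exp_minus inverse_eq_divide intro!: divide_left_mono mult_pos_pos add_pos_pos)
  \<comment> \<open>Trades the factor \<open>1 / n\<close> for a multiple of \<open>1 / y\<close>.\<close>
  have factor: "c / y * (exp (- y) - 1 + y) \<le> 4 / (3 * real n) * (exp (- y) - 1 + y)"
    if "3 * c * real n \<le> 4 * y" "y > 0" for c
    using that n pos by (intro mult_right_mono) (auto simp: field_simps)
  consider "t \<le> 1" | "1 \<le> t" "t \<le> pi / 2" | "pi / 2 \<le> t" by linarith
  then show ?thesis
  proof cases
    case 1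
    then show ?thesis using cos_power_deficit_small[of n t] assms by simp
  next
    case 2
    have "1 \<le> t\<^sup>2" using 2 by simp
    then have "real n * 1 \<le> real n * t\<^sup>2" by (intro mult_left_mono) auto
    then have ny: "real n \<le> 2 * y" by (simp add: y_def)
    then have y: "y \<ge> 3 / 2" using n by linarith
    have "0 \<le> y * (2 * y - 3)" using y by (intro mult_nonneg_nonneg) auto
    then have "(3 * y - 2) * (1 / (1 + y)) \<le> 2 * (y - 1)"
      using y by (simp add: field_simps)
    moreover have "(3 * y - 2) * exp (- y) \<le> (3 * y - 2) * (1 / (1 + y))"
      using y exp_y(2) by (intro mult_left_mono) auto
    ultimately have "(3 * y - 2) * exp (- y) \<le> 2 * (y - 1)" by linarith
    then have "exp (- y) \<le> (2 / 3) / y * (exp (- y) - 1 + y)"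
      using y by (simp add: field_simps)
    also have "\<dots> \<le> 4 / (3 * real n) * (exp (- y) - 1 + y)"
      using ny y by (intro factor) auto
    finally show ?thesis
      using zero_le_power[OF cos_ge_zero[of t], of n] 2 by linarith
  next
    case 3
    \<comment> \<open>Beyond \<open>pi / 2\<close> only \<open>cos t ^ n \<ge> -1\<close> is used, so the right-hand side has to exceed
       \<open>1\<close>; for \<open>n = 3\<close> the bound \<open>pi / 2 \<ge> 3 / 2\<close> would leave hardly any margin.\<close>
    have "31 / 20 \<le> t" using 3 pi_approx(1) by simp
    then have "(31 / 20)\<^sup>2 \<le> t\<^sup>2" by (intro power_mono) auto
    then have "12 / 5 \<le> t\<^sup>2" by (simp add: power2_eq_square)
    then have "real n * (12 / 5) \<le> real n * t\<^sup>2" by (intro mult_left_mono) auto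
    then have ny: "6 * real n \<le> 5 * y" by (simp add: y_def)
    then have y: "y \<ge> 18 / 5" using n by linarith
    have "(18 / 5) * (18 / 5) \<le> y * y" using y by (intro mult_mono) auto
    then have "10 \<le> 1 + y + y\<^sup>2 / 2" using y by (simp add: power2_eq_square)
    then have "1 / (1 + y + y\<^sup>2 / 2) \<le> 1 / 10" by (intro divide_left_mono) auto
    then have "exp (- y) \<le> 1 / 10" using exp_y(1) y by linarith
    moreover have "- 1 \<le> cos t ^ n"
      using abs_cos_le_one[of t] power_le_one[of "\<bar>cos t\<bar>" n] by (simp add: abs_le_iff flip: power_abs)
    ultimately have "exp (- y) - cos t ^ n \<le> 11 / 10" by linarith
    also have "\<dots> \<le> (8 / 5) / y * (exp (- y) - 1 + y)"
    proof -
      have "11 * y \<le> 16 * (exp (- y) - 1 + y)" using y exp_gt_zero[of "- y"] by argo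
      then show ?thesis using y by (simp add: field_simps)
    qed
    also have "\<dots> \<le> 4 / (3 * real n) * (exp (- y) - 1 + y)"
      using ny y by (intro factor) auto
    finally show ?thesis .
  qed
qed

section \<open>Moments of order between 2 and 4\<close>

text \<open>
  For \<open>2 < q < 4\<close> the integral of this kernel over \<open>t\<close> converges and, by
  homogeneity, is a positive multiple of \<open>\<bar>x\<bar>\<^sup>q\<close>. Subtracting
  \<open>1 - (t * x)\<^sup>2 / 2\<close> from the cosine makes the kernel of order \<open>t powr
  (3 - q)\<close> at \<open>0\<close> and of order \<open>t powr (1 - q)\<close> at infinity, and
  does no harm to the comparison of \<open>S\<^sub>n\<close> with a Gaussian of variance
  \<open>n\<close>, since the second moments agree.
\<close>

definition cosine_kernel :: "real \<Rightarrow> real \<Rightarrow> real \<Rightarrow> real" where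
  "cosine_kernel q x t =
     indicator {0<..} t * t powr (- q - 1) * (cos (t * x) - 1 + (t * x)\<^sup>2 / 2)"

definition cosine_const :: "real \<Rightarrow> real" where
  "cosine_const q = (\<integral>t. cosine_kernel q 1 t \<partial>lborel)"

lemma cosine_kernel_nonneg: "0 \<le> cosine_kernel q x t"
  using cos_ge_quadratic[of "t * x"] by (simp add: cosine_kernel_def)

lemma borel_measurable_cosine_kernel [measurable]:
  "(\<lambda>(x, t). cosine_kernel q (s * x) t) \<in> borel_measurable (borel \<Otimes>\<^sub>M borel)"
  "cosine_kernel q x \<in> borel_measurable borel"
  unfolding cosine_kernel_def[abs_def] by measurable

lemma integrable_powr_lborel:
  fixes a :: real
  shows "a > - 1 \<Longrightarrow> integrable lborel (\<lambda>t. indicator {0..1} t * t powr a)"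
    and "a < - 1 \<Longrightarrow> integrable lborel (\<lambda>t. indicator {1..} t * t powr a)"
proof -
  have *: "integrable lborel (\<lambda>t. indicator A t * t powr a)"
    if "(\<lambda>t. t powr a) integrable_on A" "A \<in> sets borel" for A
  proof -
    have "integrable lebesgue (\<lambda>t. indicator A t *\<^sub>R t powr a)"
      using nonnegative_absolutely_integrable_1[OF that(1)] by (simp add: set_integrable_def)
    then show ?thesis using that(2) by (subst (asm) integrable_completion) auto
  qed
  show "integrable lborel (\<lambda>t. indicator {0..1} t * t powr a)" if "a > - 1"
    using that by (intro * integrable_on_powr_from_0) auto
  show "integrable lborel (\<lambda>t. indicator {1..} t * t powr a)" if "a < - 1"
    using that has_integral_powr_to_inf[of a 1] by (intro *) (auto simp: integrable_on_def)
qed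

lemma integrable_cosine_kernel_1:
  assumes "2 < q" "q < 4"
  shows "integrable lborel (cosine_kernel q 1)"
proof (rule Bochner_Integration.integrable_bound)
  show "integrable lborel (\<lambda>t. indicator {0..1} t * t powr (3 - q) + indicator {1..} t * t powr (1 - q))"
    using assms by (intro Bochner_Integration.integrable_add integrable_powr_lborel) auto
  show "AE t in lborel. norm (cosine_kernel q 1 t)
      \<le> norm (indicator {0..1} t * t powr (3 - q) + indicator {1..} t * t powr (1 - q))"
  proof (rule AE_I2)
    fix t :: real
    have p: "t powr (- q - 1) * t ^ k = t powr (real k - q - 1)" if "t > 0" for k
    proof -
      have "t powr (- q - 1) * t ^ k = t powr (- q - 1 + real k)"
        using that by (simp add: powr_add powr_realpow)
      then show ?thesis by (simp add: algebra_simps)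
    qed
    have "cosine_kernel q 1 t \<le> indicator {0..1} t * t powr (3 - q) + indicator {1..} t * t powr (1 - q)"
    proof (cases "t > 0")
      case True
      consider "t \<le> 1" | "t \<ge> 1" by linarith
      then show ?thesis
      proof cases
        case 1
        have "cos t - 1 + t\<^sup>2 / 2 \<le> t ^ 4"
          using cos_le_quartic[of t] zero_le_power[of t 4] True by linarith
        then have "cosine_kernel q 1 t \<le> t powr (- q - 1) * t ^ 4"
          using True by (auto simp: cosine_kernel_def intro!: mult_left_mono)
        then have "cosine_kernel q 1 t \<le> t powr (3 - q)" using p[of 4] True by simp
        then show ?thesis using 1 True by (auto simp: indicator_def)
      next
        case 2
        have "cos t - 1 + t\<^sup>2 / 2 \<le> t\<^sup>2"
          using cos_le_one[of t] zero_le_power2[of t] by linarith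
        then have "cosine_kernel q 1 t \<le> t powr (- q - 1) * t ^ 2"
          using True by (auto simp: cosine_kernel_def intro!: mult_left_mono)
        then have "cosine_kernel q 1 t \<le> t powr (1 - q)" using p[of 2] True by simp
        then show ?thesis using 2 True by (auto simp: indicator_def)
      qed
    qed (simp add: cosine_kernel_def)
    then show "norm (cosine_kernel q 1 t)
      \<le> norm (indicator {0..1} t * t powr (3 - q) + indicator {1..} t * t powr (1 - q))"
      using cosine_kernel_nonneg[of q 1 t] by simp
  qed
qed simp

text \<open>
  Any interval on which the kernel is bounded away from \<open>0\<close> will do; on \<open>[4,
  5]\<close> the term \<open>t\<^sup>2 / 2\<close> dominates the cosine.
\<close>

lemma cosine_const_pos:
  assumes "2 < q" "q < 4"
  shows "0 < cosine_const q"
proof -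
  let ?c = "5 powr (- q - 1) :: real"
  have "?c * indicator {4..5} t \<le> cosine_kernel q 1 t" for t
  proof (cases "t \<in> {4..5}")
    case True
    have "?c \<le> t powr (- q - 1)" using True assms by (intro powr_mono2') auto
    moreover have "4\<^sup>2 \<le> t\<^sup>2" using True by (intro power_mono) auto
    then have "16 \<le> t\<^sup>2" by simp
    then have "1 \<le> cos t - 1 + t\<^sup>2 / 2" using cos_ge_minus_one[of t] by linarith
    ultimately have "?c * 1 \<le> t powr (- q - 1) * (cos t - 1 + t\<^sup>2 / 2)"
      by (intro mult_mono) auto
    then show ?thesis using True by (simp add: cosine_kernel_def)
  qed (simp add: cosine_kernel_nonneg)
  then have "(\<integral>t. ?c * indicator {4..5::real} t \<partial>lborel) \<le> cosine_const q"
    unfolding cosine_const_def using integrable_cosine_kernel_1[OF assms]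
    by (intro integral_mono) auto
  moreover have "(\<integral>t. ?c * indicator {4..5::real} t \<partial>lborel) = ?c"
    by simp
  moreover have "?c > 0" by simp
  ultimately show ?thesis by linarith
qed

text \<open>
  Substituting \<open>t / \<bar>x\<bar>\<close> for \<open>t\<close> reduces the integral to the
  one for \<open>x = 1\<close>.
\<close>

lemma cosine_kernel_integral:
  assumes "2 < q" "q < 4"
  shows "integrable lborel (cosine_kernel q x)"
    and "(\<integral>t. cosine_kernel q x t \<partial>lborel) = cosine_const q * \<bar>x\<bar> powr q"
proof -
  have "integrable lborel (cosine_kernel q x) \<and>
    (\<integral>t. cosine_kernel q x t \<partial>lborel) = cosine_const q * \<bar>x\<bar> powr q"
  proof (cases "x = 0")
    case True
    then have "cosine_kernel q x = (\<lambda>t. 0)" by (simp add: cosine_kernel_def fun_eq_iff)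
    then show ?thesis using True by simp
  next
    case False
    let ?a = "\<bar>x\<bar>"
    have a: "?a > 0" using False by simp
    have scale: "cosine_kernel q x t = ?a powr (q + 1) * cosine_kernel q 1 (0 + ?a * t)" for t
    proof (cases "t > 0")
      case True
      have "cos (t * x) = cos (?a * t)" by (cases "x \<ge> 0") (auto simp: mult.commute)
      moreover have "t powr (- q - 1) = ?a powr (q + 1) * (?a * t) powr (- q - 1)"
        using a True by (simp add: powr_mult flip: powr_add mult.assoc)
      ultimately show ?thesis
        using a True by (simp add: cosine_kernel_def power_mult_distrib mult_ac)
    next
      case False
      then have "\<not> 0 < ?a * t" using a by (simp add: zero_less_mult_iff)
      then show ?thesis using False by (simp add: cosine_kernel_def)
    qed
    note int1 = integrable_cosine_kernel_1[OF assms]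
    have "integrable lborel (\<lambda>t. cosine_kernel q 1 (0 + ?a * t))"
      using lborel_integrable_real_affine[OF int1, of ?a 0] False by simp
    then have "integrable lborel (cosine_kernel q x)"
      unfolding scale[abs_def] by (rule integrable_mult_right)
    moreover have "cosine_const q = ?a * (\<integral>t. cosine_kernel q 1 (0 + ?a * t) \<partial>lborel)"
      unfolding cosine_const_def
      using lborel_integral_real_affine[of ?a "cosine_kernel q 1" 0] False by simp
    then have "(\<integral>t. cosine_kernel q x t \<partial>lborel) = ?a powr (q + 1) * (cosine_const q / ?a)"
      unfolding scale[abs_def] using a by simp
    moreover have "?a powr (q + 1) = ?a powr q * ?a" using a by (simp add: powr_add)
    ultimately show ?thesis using a by simp
  qed
  then show "integrable lborel (cosine_kernel q x)"
    and "(\<integral>t. cosine_kernel q x t \<partial>lborel) = cosine_const q * \<bar>x\<bar> powr q" by auto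
qed

lemma walk_mean_cosine_kernel:
  "walk_mean n (\<lambda>x. cosine_kernel q x t)
     = indicator {0<..} t * t powr (- q - 1) * (cos t ^ n - 1 + real n * t\<^sup>2 / 2)"
proof -
  let ?c = "indicator {0<..} t * t powr (- q - 1)"
  have "(\<lambda>x. cosine_kernel q x t) = (\<lambda>x. ?c * (cos (t * x) + ((- 1) + t\<^sup>2 / 2 * x\<^sup>2)))"
    by (simp add: cosine_kernel_def power_mult_distrib fun_eq_iff)
  then have "walk_mean n (\<lambda>x. cosine_kernel q x t)
      = ?c * (cos t ^ n + ((- 1) + t\<^sup>2 / 2 * real n))"
    by (simp only: walk_mean_cmult walk_mean_add walk_mean_cos walk_mean_square walk_mean_const)
  then show ?thesis by (simp add: algebra_simps)
qed

lemma std_normal_cos: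
  shows "integrable std_normal_distribution (\<lambda>x. cos (t * x))"
    and "(\<integral>x. cos (t * x) \<partial>std_normal_distribution) = exp (- t\<^sup>2 / 2)"
proof -
  interpret real_distribution std_normal_distribution
    by (rule real_dist_normal_dist)
  have int: "integrable std_normal_distribution (\<lambda>x. iexp (t * x))"
    by (rule integrable_iexp) auto
  have "(\<integral>x. Re (iexp (t * x)) \<partial>std_normal_distribution) = Re (char std_normal_distribution t)"
    unfolding char_def using int by (rule integral_Re)
  also have "\<dots> = exp (- t\<^sup>2 / 2)"
    by (simp add: char_std_normal_distribution)
  finally show "(\<integral>x. cos (t * x) \<partial>std_normal_distribution) = exp (- t\<^sup>2 / 2)"
    by (simp add: Re_exp)
  show "integrable std_normal_distribution (\<lambda>x. cos (t * x))"
    by (rule integrable_const_bound[where B=1]) auto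
qed

lemma std_normal_square:
  shows "integrable std_normal_distribution (\<lambda>x. x\<^sup>2)"
    and "(\<integral>x. x\<^sup>2 \<partial>std_normal_distribution) = 1"
  using std_normal_distribution_even_moments[of 1] by (simp_all add: fact_numeral)

lemma std_normal_cosine_kernel:
  "(\<integral>x. cosine_kernel q (s * x) t \<partial>std_normal_distribution)
     = indicator {0<..} t * t powr (- q - 1) * (exp (- (s\<^sup>2 * t\<^sup>2 / 2)) - 1 + s\<^sup>2 * t\<^sup>2 / 2)"
proof -
  interpret real_distribution std_normal_distribution
    by (rule real_dist_normal_dist)
  let ?c = "indicator {0<..} t * t powr (- q - 1)"
  have "(\<integral>x. cosine_kernel q (s * x) t \<partial>std_normal_distribution)
      = (\<integral>x. ?c * (cos (t * s * x) - 1 + (t * s)\<^sup>2 / 2 * x\<^sup>2) \<partial>std_normal_distribution)"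
    by (simp add: cosine_kernel_def power_mult_distrib mult_ac)
  also have "\<dots> = ?c * (exp (- (t * s)\<^sup>2 / 2) - 1 + (t * s)\<^sup>2 / 2)"
    using std_normal_cos[of "t * s"] std_normal_square prob_space by simp
  finally show ?thesis by (simp add: power_mult_distrib mult_ac)
qed

text \<open>
  The Gaussian moment as an integral over \<open>t\<close>, by exchanging the two integrations;
  the kernel is nonnegative, so integrability on the product follows from finiteness of the
  moment.
\<close>

lemma std_normal_cosine_representation:
  assumes "2 < q" "q < 4" and "s \<ge> 0"
  shows "integrable lborel (\<lambda>t. \<integral>x. cosine_kernel q (s * x) t \<partial>std_normal_distribution)"
    and "(\<integral>t. (\<integral>x. cosine_kernel q (s * x) t \<partial>std_normal_distribution) \<partial>lborel)
           = cosine_const q * s powr q * gauss_moment q"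
proof -
  interpret G: real_distribution std_normal_distribution
    by (rule real_dist_normal_dist)
  interpret pair_sigma_finite std_normal_distribution lborel
    by standard
  have inner: "(\<integral>t. cosine_kernel q (s * x) t \<partial>lborel)
      = cosine_const q * s powr q * \<bar>x\<bar> powr q" for x
    using cosine_kernel_integral(2)[OF assms(1,2)] assms(3) by (simp add: abs_mult powr_mult)
  have int: "integrable (std_normal_distribution \<Otimes>\<^sub>M lborel) (\<lambda>(x, t). cosine_kernel q (s * x) t)"
  proof (rule Fubini_integrable)
    have "integrable std_normal_distribution (\<lambda>x. cosine_const q * s powr q * \<bar>x\<bar> powr q)"
      using assms by (intro integrable_mult_right std_normal_abs_powr) auto
    then show "integrable std_normal_distribution
        (\<lambda>x. \<integral>t. norm (case (x, t) of (x, t) \<Rightarrow> cosine_kernel q (s * x) t) \<partial>lborel)"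
      by (simp add: inner cosine_kernel_nonneg)
    show "AE x in std_normal_distribution.
        integrable lborel (\<lambda>t. case (x, t) of (x, t) \<Rightarrow> cosine_kernel q (s * x) t)"
      using cosine_kernel_integral(1)[OF assms(1,2)] by simp
  qed (measurable)
  show "integrable lborel (\<lambda>t. \<integral>x. cosine_kernel q (s * x) t \<partial>std_normal_distribution)"
    using integrable_snd[OF int] .
  show "(\<integral>t. (\<integral>x. cosine_kernel q (s * x) t \<partial>std_normal_distribution) \<partial>lborel)
           = cosine_const q * s powr q * gauss_moment q"
    using Fubini_integral[OF int] by (simp add: inner gauss_moment_def)
qed

text \<open>
  Both moments are integrals, against the same positive weight, of quantities that depend on the
  characteristic functions only. So the pointwise inequality \<open>cos_power_deficit\<close>
  integrates to an inequality of moments, and the positive constant in front of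
  \<open>\<bar>x\<bar>\<^sup>q\<close> cancels.
\<close>

lemma walk_moment_between_2_and_4:
  assumes "2 < q" "q < 4" and n: "n \<ge> 3"
  shows "(1 - 4 / (3 * real n)) * (real n powr (q / 2) * gauss_moment q)
           \<le> walk_mean n (\<lambda>x. \<bar>x\<bar> powr q)"
proof -
  let ?\<rho> = "1 - 4 / (3 * real n)"
  let ?H = "\<lambda>t. \<integral>x. cosine_kernel q (sqrt (real n) * x) t \<partial>std_normal_distribution"
  let ?F = "\<lambda>t. walk_mean n (\<lambda>x. cosine_kernel q x t)"
  note ker = cosine_kernel_integral[OF assms(1,2)]
  have H: "integrable lborel ?H"
    "(\<integral>t. ?H t \<partial>lborel) = cosine_const q * sqrt (real n) powr q * gauss_moment q"
    using std_normal_cosine_representation[OF assms(1,2), of "sqrt (real n)"] by auto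
  have F: "integrable lborel ?F"
    "(\<integral>t. ?F t \<partial>lborel) = cosine_const q * walk_mean n (\<lambda>x. \<bar>x\<bar> powr q)"
    using walk_mean_integral[of lborel "cosine_kernel q" n] ker by (auto simp: walk_mean_cmult)
  have "?\<rho> * ?H t \<le> ?F t" for t
  proof (cases "t > 0")
    case True
    let ?y = "real n * t\<^sup>2 / 2"
    have "?\<rho> * (exp (- ?y) - 1 + ?y) \<le> cos t ^ n - 1 + ?y"
      using cos_power_deficit[OF n, of t] True by (simp only: left_diff_distrib) simp
    then have "t powr (- q - 1) * (?\<rho> * (exp (- ?y) - 1 + ?y)) \<le> t powr (- q - 1) * (cos t ^ n - 1 + ?y)"
      by (intro mult_left_mono) auto
    moreover have "?H t = t powr (- q - 1) * (exp (- ?y) - 1 + ?y)"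
      using True by (simp only: std_normal_cosine_kernel) simp
    moreover have "?F t = t powr (- q - 1) * (cos t ^ n - 1 + ?y)"
      using True by (simp only: walk_mean_cosine_kernel) simp
    ultimately show ?thesis by (simp only: mult.left_commute)
  qed (simp add: walk_mean_cosine_kernel std_normal_cosine_kernel)
  then have "(\<integral>t. ?\<rho> * ?H t \<partial>lborel) \<le> (\<integral>t. ?F t \<partial>lborel)"
    using H(1) F(1) by (intro integral_mono integrable_mult_right) auto
  then have "cosine_const q * (?\<rho> * (sqrt (real n) powr q * gauss_moment q))
      \<le> cosine_const q * walk_mean n (\<lambda>x. \<bar>x\<bar> powr q)"
    using H(2) F(2) by (simp add: mult_ac)
  then have "?\<rho> * (sqrt (real n) powr q * gauss_moment q) \<le> walk_mean n (\<lambda>x. \<bar>x\<bar> powr q)"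
    using cosine_const_pos[OF assms(1,2)] by simp
  moreover have "sqrt (real n) powr q = real n powr (q / 2)"
    by (simp add: powr_half_sqrt[symmetric] powr_powr)
  ultimately show ?thesis by simp
qed

section \<open>Moments of all orders from 2 on\<close>

definition walk_moment_bound :: "real \<Rightarrow> nat \<Rightarrow> bool" where
  "walk_moment_bound q n \<longleftrightarrow>
     exp (- q\<^sup>2 / (2 * real n)) * (real n powr (q / 2) * gauss_moment q)
       \<le> walk_mean n (\<lambda>x. \<bar>x\<bar> powr q)"

text \<open>
  For \<open>q \<ge> n\<close> the two extreme values \<open>\<plusminus>n\<close> of the walk
  suffice. With the Gaussian moment replaced by its upper bound \<open>2 * (4 * q / (3 * exp 1))
  powr (q / 2)\<close>, taking logarithms and estimating \<open>ln (q / n) \<le> q / n - 1\<close>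
  reduces the claim to \<open>n * ln 2 \<le> q * (1 - ln (4 / 3) / 2)\<close>.
\<close>

lemma walk_moment_bound_large_exponent:
  assumes "n \<ge> 1" "real n \<le> q"
  shows "walk_moment_bound q n"
proof -
  let ?n = "real n"
  have n: "?n \<ge> 1" and q: "q \<ge> 1" using assms by linarith+
  have gauss: "gauss_moment q \<le> 2 * (4 * q / (3 * exp 1)) powr (q / 2)"
    using q by (intro std_normal_abs_powr) auto
  have "ln q - ln ?n \<le> q / ?n - 1"
    using ln_le_minus_one[of "q / ?n"] n q by (simp add: ln_div)
  then have "q / 2 * (ln q - ln ?n) \<le> q / 2 * (q / ?n - 1)"
    using q by (intro mult_left_mono) auto
  then have 1: "q / 2 * ln q \<le> q / 2 * ln ?n + q\<^sup>2 / (2 * ?n) - q / 2"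
    by (simp add: algebra_simps power2_eq_square)
  have "ln (4 / 3 :: real) \<le> 1 / 3" using ln_le_minus_one[of "4 / 3"] by simp
  then have 2: "q / 2 * ln (4 / 3) \<le> q / 2 * (1 / 3)" using q by (intro mult_left_mono) auto
  have "?n * ln 2 \<le> ?n * (5 / 6)" using ln2_le_25_over_36 by (intro mult_left_mono) auto
  then have 3: "?n * ln 2 \<le> q * (5 / 6)" using assms by linarith
  have lnc: "ln (4 * q / (3 * exp 1)) = ln (4 / 3) + ln q - 1"
    using q by (simp add: ln_div ln_mult)
  have "- q\<^sup>2 / (2 * ?n) + (q / 2 * ln ?n + (ln 2 + q / 2 * (ln (4 / 3) + ln q - 1)))
      \<le> ln 2 + q * ln ?n - ?n * ln 2"
    using 1 2 3 by (simp add: algebra_simps)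
  then have "exp (- q\<^sup>2 / (2 * ?n) + (q / 2 * ln ?n + (ln 2 + q / 2 * (ln (4 / 3) + ln q - 1))))
      \<le> exp (ln 2 + q * ln ?n - ?n * ln 2)"
    by (simp only: exp_le_cancel_iff)
  also have "exp (- q\<^sup>2 / (2 * ?n) + (q / 2 * ln ?n + (ln 2 + q / 2 * (ln (4 / 3) + ln q - 1))))
      = exp (- q\<^sup>2 / (2 * ?n)) * (?n powr (q / 2) * (2 * (4 * q / (3 * exp 1)) powr (q / 2)))"
  proof -
    have "?n powr (q / 2) = exp (q / 2 * ln ?n)"
      "(4 * q / (3 * exp 1)) powr (q / 2) = exp (q / 2 * (ln (4 / 3) + ln q - 1))"
      using n q by (simp_all add: powr_def lnc)
    moreover have "exp (ln 2) = (2 :: real)" by simp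
    ultimately show ?thesis by (simp only: exp_add)
  qed
  also have "exp (ln 2 + q * ln ?n - ?n * ln 2) = 2 * ?n powr q / 2 ^ n"
  proof -
    have "exp (?n * ln 2) = 2 ^ n" by (simp add: exp_of_nat_mult)
    then show ?thesis using n by (simp add: powr_def exp_add exp_diff)
  qed
  also have "\<dots> \<le> walk_mean n (\<lambda>x. \<bar>x\<bar> powr q)"
    using walk_mean_ge_endpoints[of "\<lambda>x. \<bar>x\<bar> powr q" "n - 1"] assms(1) by simp
  finally have "exp (- q\<^sup>2 / (2 * ?n)) * (?n powr (q / 2) * (2 * (4 * q / (3 * exp 1)) powr (q / 2)))
      \<le> walk_mean n (\<lambda>x. \<bar>x\<bar> powr q)" .
  moreover have "exp (- q\<^sup>2 / (2 * ?n)) * (?n powr (q / 2) * gauss_moment q)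
      \<le> exp (- q\<^sup>2 / (2 * ?n)) * (?n powr (q / 2) * (2 * (4 * q / (3 * exp 1)) powr (q / 2)))"
    using gauss by (intro mult_left_mono) auto
  ultimately show ?thesis unfolding walk_moment_bound_def by linarith
qed

text \<open>
  The loss \<open>1 - 4 / (3 * n)\<close> is compared with \<open>exp (- 2 / n) \<le> 1 - 2 / n +
  2 / n\<^sup>2\<close>, where \<open>n \<ge> 3\<close> enters. At \<open>q = 2\<close>, where the
  cosine representation breaks down, both moments are explicit.
\<close>

lemma walk_moment_bound_small_exponent:
  assumes "2 \<le> q" "q < 4" "n \<ge> 3"
  shows "walk_moment_bound q n"
proof -
  let ?n = "real n"
  have nonneg: "0 \<le> ?n powr (q / 2) * gauss_moment q"
    using gauss_moment_nonneg by simp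
  show ?thesis
  proof (cases "q = 2")
    case True
    have "gauss_moment 2 = 1"
      using std_normal_square(2) by (simp add: gauss_moment_def)
    moreover have "walk_mean n (\<lambda>x. \<bar>x\<bar> powr 2) = ?n"
      using walk_mean_square[of n] by simp
    ultimately show ?thesis
      using True assms(3) by (simp add: walk_moment_bound_def)
  next
    case False
    have "exp (- q\<^sup>2 / (2 * ?n)) \<le> exp (- (2 / ?n))"
    proof -
      have "2\<^sup>2 \<le> q\<^sup>2" using assms by (intro power_mono) auto
      then show ?thesis using assms(3) by (simp add: field_simps)
    qed
    also have "\<dots> \<le> 1 - 2 / ?n + (2 / ?n)\<^sup>2 / 2"
      by (rule exp_minus_le_quadratic) simp
    also have "\<dots> \<le> 1 - 4 / (3 * ?n)"
      using assms(3) by (simp add: field_simps power2_eq_square)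
    finally have "exp (- q\<^sup>2 / (2 * ?n)) * (?n powr (q / 2) * gauss_moment q)
        \<le> (1 - 4 / (3 * ?n)) * (?n powr (q / 2) * gauss_moment q)"
      using nonneg by (rule mult_right_mono)
    also have "\<dots> \<le> walk_mean n (\<lambda>x. \<bar>x\<bar> powr q)"
      using assms False by (intro walk_moment_between_2_and_4) auto
    finally show ?thesis unfolding walk_moment_bound_def .
  qed
qed

text \<open>
  The counterpart for the walk of \<open>E \<bar>G\<bar> powr q = (q - 1) * E \<bar>G\<bar> powr
  (q - 2)\<close>, as an inequality: apply the discrete integration by parts to \<open>f x = x *
  \<bar>x\<bar> powr (q - 2)\<close> and bound the central difference by convexity.
\<close>

lemma walk_moment_step:
  assumes "q \<ge> 3"
  shows "real (Suc m) * (q - 1) * walk_mean m (\<lambda>x. \<bar>x\<bar> powr (q - 2))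
           \<le> walk_mean (Suc m) (\<lambda>x. \<bar>x\<bar> powr q)"
proof -
  let ?f = "\<lambda>x::real. x * \<bar>x\<bar> powr (q - 2)"
  have "\<bar>x\<bar> powr q = x * ?f x" for x :: real
  proof (cases "x = 0")
    case False
    have "x * ?f x = \<bar>x\<bar> powr 2 * \<bar>x\<bar> powr (q - 2)"
      using False by (simp add: power2_eq_square mult.assoc)
    also have "\<dots> = \<bar>x\<bar> powr q" unfolding powr_add[symmetric] by simp
    finally show ?thesis by simp
  qed simp
  then have "walk_mean (Suc m) (\<lambda>x. \<bar>x\<bar> powr q) = walk_mean (Suc m) (\<lambda>x. x * ?f x)"
    by simp
  also have "\<dots> = real (Suc m) * walk_mean m (\<lambda>x. (?f (x + 1) - ?f (x - 1)) / 2)"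
    by (rule walk_mean_stein)
  also have "\<dots> \<ge> real (Suc m) * walk_mean m (\<lambda>x. (q - 1) * \<bar>x\<bar> powr (q - 2))"
    using signed_powr_increment_ge[of "q - 2"] assms
    by (intro mult_left_mono walk_mean_mono) (auto simp: algebra_simps)
  finally show ?thesis by (simp add: walk_mean_cmult mult_ac)
qed

text \<open>
  The Gaussian and the walk gain the same factor \<open>q - 1\<close> in this step, so only the
  elementary factors have to be compared. With \<open>m = n - 1\<close> and \<open>ln (n / m)
  \<le> 1 / m\<close>, the exponents match as soon as \<open>q\<^sup>2 \<le> n * (3 * q -
  2)\<close>, which \<open>q \<le> n\<close> guarantees with room to spare.
\<close>

lemma walk_moment_bound_step:
  assumes "q \<ge> 4" "real (Suc m) \<ge> q" "walk_moment_bound (q - 2) m"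
  shows "walk_moment_bound q (Suc m)"
proof -
  let ?m = "real m" and ?n = "real (Suc m)"
  have m: "?m \<ge> 3" using assms by simp
  have "ln (?n / ?m) \<le> ?n / ?m - 1" using m by (intro ln_le_minus_one) auto
  then have "ln ?n - ln ?m \<le> 1 / ?m" using m by (simp add: ln_div field_simps)
  then have "(q / 2 - 1) * (ln ?n - ln ?m) \<le> (q / 2 - 1) * (1 / ?m)"
    using assms by (intro mult_left_mono) auto
  also have "\<dots> \<le> q\<^sup>2 / (2 * ?n) - (q - 2)\<^sup>2 / (2 * ?m)"
  proof -
    have "q * q \<le> ?n * q" using assms by (intro mult_right_mono) auto
    also have "\<dots> \<le> ?n * (3 * q - 2)" using assms by (intro mult_left_mono) auto
    finally have "q * q \<le> ?n * (3 * q - 2)" .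
    moreover have "q\<^sup>2 / (2 * (x + 1)) - (q - 2)\<^sup>2 / (2 * x) - (q / 2 - 1) * (1 / x)
        = ((x + 1) * (3 * q - 2) - q * q) / (2 * (x + 1) * x)" if "x > 0" for x :: real
      using that by (simp add: divide_simps) (simp add: algebra_simps power2_eq_square)
    from this[of ?m] have "q\<^sup>2 / (2 * ?n) - (q - 2)\<^sup>2 / (2 * ?m) - (q / 2 - 1) * (1 / ?m)
        = (?n * (3 * q - 2) - q * q) / (2 * ?n * ?m)"
      using m by (simp only: of_nat_Suc add.commute[of 1])
    ultimately have "0 \<le> q\<^sup>2 / (2 * ?n) - (q - 2)\<^sup>2 / (2 * ?m) - (q / 2 - 1) * (1 / ?m)"
      by (simp del: of_nat_Suc)
    then show ?thesis by linarith
  qed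
  finally have "- q\<^sup>2 / (2 * ?n) + q / 2 * ln ?n \<le> - (q - 2)\<^sup>2 / (2 * ?m) + ((q - 2) / 2 * ln ?m + ln ?n)"
    by (simp add: algebra_simps diff_divide_distrib)
  then have "exp (- q\<^sup>2 / (2 * ?n) + q / 2 * ln ?n)
      \<le> exp (- (q - 2)\<^sup>2 / (2 * ?m) + ((q - 2) / 2 * ln ?m + ln ?n))"
    by (simp only: exp_le_cancel_iff)
  moreover have "?n powr (q / 2) = exp (q / 2 * ln ?n)"
    "?m powr ((q - 2) / 2) = exp ((q - 2) / 2 * ln ?m)" "exp (ln ?n) = ?n"
    using m by (simp_all add: powr_def)
  ultimately have "exp (- q\<^sup>2 / (2 * ?n)) * ?n powr (q / 2)
      \<le> exp (- (q - 2)\<^sup>2 / (2 * ?m)) * (?m powr ((q - 2) / 2) * ?n)"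
    by (simp only: exp_add)
  then have "exp (- q\<^sup>2 / (2 * ?n)) * ?n powr (q / 2) * gauss_moment q
      \<le> exp (- (q - 2)\<^sup>2 / (2 * ?m)) * (?m powr ((q - 2) / 2) * ?n) * gauss_moment q"
    by (rule mult_right_mono) (rule gauss_moment_nonneg)
  also have "\<dots> = ?n * (q - 1) * (exp (- (q - 2)\<^sup>2 / (2 * ?m)) * (?m powr ((q - 2) / 2) * gauss_moment (q - 2)))"
    using gauss_moment_step[of q] assms by simp
  also have "\<dots> \<le> ?n * (q - 1) * walk_mean m (\<lambda>x. \<bar>x\<bar> powr (q - 2))"
    using assms unfolding walk_moment_bound_def by (intro mult_left_mono) auto
  also have "\<dots> \<le> walk_mean (Suc m) (\<lambda>x. \<bar>x\<bar> powr q)"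
    using assms by (intro walk_moment_step) auto
  finally show ?thesis by (simp add: walk_moment_bound_def mult.assoc)
qed

text \<open>
  When the exponent is below \<open>n\<close>, it is lowered by \<open>2\<close> together with one
  sign until it drops below \<open>4\<close>; once it is at least the number of signs, the extreme
  values of the walk decide.
\<close>

lemma walk_moment_bound:
  assumes "q \<ge> 2" "n \<ge> 1"
  shows "walk_moment_bound q n"
  using assms(2,1)
proof (induction n arbitrary: q rule: dec_induct)
  case base
  then show ?case by (intro walk_moment_bound_large_exponent) auto
next
  case (step m)
  consider "real (Suc m) \<le> q" | "q < real (Suc m)" "q < 4" | "q < real (Suc m)" "4 \<le> q"
    by linarith
  then show ?case
  proof cases
    case 1
    then show ?thesis by (intro walk_moment_bound_large_exponent) auto
  next
    case 2
    then show ?thesis using step.prems by (intro walk_moment_bound_small_exponent) auto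
  next
    case 3
    then show ?thesis by (intro walk_moment_bound_step step.IH) auto
  qed
qed

theorem proposition3:
  fixes M :: "'a measure" and \<epsilon> :: "nat \<Rightarrow> 'a \<Rightarrow> real"
    and N :: "'b measure" and G :: "'b \<Rightarrow> real"
    and n :: nat and p :: real
  assumes "prob_space M"
    and "prob_space.indep_vars M (\<lambda>_. borel) \<epsilon> {1..n}"
    and "\<And>i. i \<in> {1..n} \<Longrightarrow> rademacher M (\<epsilon> i)"
    and "prob_space N"
    and "distributed N lborel G (\<lambda>x. ennreal (std_normal_density x))"
    and "n \<ge> 1"
    and "p \<ge> 3"
  shows "Lp_norm M p (\<lambda>\<omega>. (\<Sum>i=1..n. \<epsilon> i \<omega>) / sqrt (real n))
           \<ge> exp (- p / (2 * real n)) * Lp_norm N p G"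
proof -
  let ?n = "real n"
  interpret M: prob_space M by fact
  have "(\<integral>\<omega>. \<bar>G \<omega>\<bar> powr p \<partial>N) = (\<integral>x. std_normal_density x * \<bar>x\<bar> powr p \<partial>lborel)"
    using distributed_integral[OF assms(5), of "\<lambda>x. \<bar>x\<bar> powr p"] by simp
  then have G: "(\<integral>\<omega>. \<bar>G \<omega>\<bar> powr p \<partial>N) = gauss_moment p"
    by (simp add: gauss_moment_def integral_density)
  have "(\<integral>\<omega>. \<bar>(\<Sum>i=1..n. \<epsilon> i \<omega>) / sqrt ?n\<bar> powr p \<partial>M)
      = walk_mean n (\<lambda>x. \<bar>x / sqrt ?n\<bar> powr p)"
    by (rule M.rademacher_sum_expectation(2)[OF assms(2,3)]) auto
  also have "\<dots> = walk_mean n (\<lambda>x. 1 / ?n powr (p / 2) * \<bar>x\<bar> powr p)"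
    by (simp add: powr_divide powr_half_sqrt[symmetric] powr_powr)
  also have "\<dots> = walk_mean n (\<lambda>x. \<bar>x\<bar> powr p) / ?n powr (p / 2)"
    by (simp only: walk_mean_cmult) simp
  finally have S: "(\<integral>\<omega>. \<bar>(\<Sum>i=1..n. \<epsilon> i \<omega>) / sqrt ?n\<bar> powr p \<partial>M)
      = walk_mean n (\<lambda>x. \<bar>x\<bar> powr p) / ?n powr (p / 2)" .
  have "walk_moment_bound p n" using assms by (intro walk_moment_bound) auto
  then have "exp (- p\<^sup>2 / (2 * ?n)) * gauss_moment p \<le> walk_mean n (\<lambda>x. \<bar>x\<bar> powr p) / ?n powr (p / 2)"
    using assms(6) by (simp add: walk_moment_bound_def field_simps)
  then have "(exp (- p\<^sup>2 / (2 * ?n)) * gauss_moment p) powr (1 / p)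
      \<le> (walk_mean n (\<lambda>x. \<bar>x\<bar> powr p) / ?n powr (p / 2)) powr (1 / p)"
    using assms(7) gauss_moment_nonneg by (intro powr_mono2) auto
  moreover have "(exp (- p\<^sup>2 / (2 * ?n)) * gauss_moment p) powr (1 / p)
      = exp (- p / (2 * ?n)) * gauss_moment p powr (1 / p)"
  proof -
    have "exp (- p\<^sup>2 / (2 * ?n)) powr (1 / p) = exp (- p / (2 * ?n))"
      using assms(7) by (simp add: powr_def power2_eq_square)
    then show ?thesis using gauss_moment_nonneg by (simp add: powr_mult)
  qed
  ultimately show ?thesis by (simp only: Lp_norm_def G S)
qed

end
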